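(* For all natural numbers $n > m \geq 0$ and $0 \leq t \leq n$, \[ d^t_{n,m} = d^t_{n,m-1} + \sum_{k=1}^{n-m-1} d^{t-k}_{n-k,m-1} \binom{b_{m,m-1}}{k} + \binom{b_{m,m-1}}{n-m} \sum_{k=0}^m d^{t-n+m}_{k,k-1}, \] where $d^t_{0,-1} = 1$ and $d^t_{n,-1} = 0$ for all $n \geq 1$ and $t \geq 0$, and where $\binom{a}{b} = 0$ if $a < b$.
   Context: The adjunctive hierarchy of hereditarily finite sets is defined by $A_0 := \{\emptyset\}$ and $A_{n+1} := \{\emptyset\} \cup \{ x \cup \{y\} : x, y \in A_n\}$, with the convention $A_n := \emptyset$ for integers $n<0$. For integers $n,m$, $b_{n,m} := |\{ x \in A_n \setminus A_{n-1} : x \subseteq A_m\}|$. For integers $n, m, t$, let $D^t_{n,m} := \{ x \in A_n \setminus A_{n-1} : x \subseteq A_m \text{ and } |x| \leq t\}$ and $d^t_{n,m} := |D^t_{n,m}|$ (so $d^t_{n,m} = 0$ when $t < 0$). *)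

theory Defs
  imports Main "HOL-Library.FSet"
begin

(* Every hereditarily finite set is uniquely a finite set of hereditarily finite sets;
   being a datatype, the type is extensional and well-founded. *)
datatype hf = HF (elts: "hf fset")

definition hempty :: hf where
  "hempty = HF {||}"

(* x \<union> {y} *)
definition adjoin :: "hf \<Rightarrow> hf \<Rightarrow> hf" where
  "adjoin x y = HF (elts x |\<union>| {|y|})"

fun adj_level :: "nat \<Rightarrow> hf set" where
  "adj_level 0 = {hempty}"
| "adj_level (Suc n) = {hempty} \<union> {adjoin x y | x y. x \<in> adj_level n \<and> y \<in> adj_level n}"

(* A_n for integer n, empty at negative indices *)
definition A :: "int \<Rightarrow> hf set" where
  "A n = (if n < 0 then {} else adj_level (nat n))"

definition bnum :: "int \<Rightarrow> int \<Rightarrow> nat" where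
  "bnum n m = card {x \<in> A n - A (n - 1). fset (elts x) \<subseteq> A m}"

(* The superscript t comes first: Dset t n m is D^t_{n,m}, dnum t n m is d^t_{n,m}. *)
definition Dset :: "int \<Rightarrow> int \<Rightarrow> int \<Rightarrow> hf set" where
  "Dset t n m = {x \<in> A n - A (n - 1). fset (elts x) \<subseteq> A m \<and> int (fcard (elts x)) \<le> t}"

definition dnum :: "int \<Rightarrow> int \<Rightarrow> int \<Rightarrow> nat" where
  "dnum t n m = card (Dset t n m)"

(* card is 0 on infinite sets, so finiteness is recorded here to confirm that
   bnum and dnum are genuine cardinalities. *)
lemma finite_adj_level: "finite (adj_level n)"
proof (induction n)
  case 0
  show ?case by simp
next
  case (Suc n)
  have "{adjoin x y | x y. x \<in> adj_level n \<and> y \<in> adj_level n}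
      = (\<lambda>(x, y). adjoin x y) ` (adj_level n \<times> adj_level n)"
    by auto
  with Suc show ?case by simp
qed

lemma finite_A: "finite (A n)"
  by (simp add: A_def finite_adj_level)

lemma finite_Dset: "finite (Dset t n m)"
  by (simp add: Dset_def finite_A)

end

theory Submission
  imports Defs
begin

text \<open>
  Greedily adjoining the elements of a set in order of increasing level shows that
  \<open>x \<in> A\<^sub>n\<close> if and only if \<open>\<bar>x - A\<^sub>i\<bar> \<le> n - 1 - i\<close> for all \<open>-1 \<le> i < n\<close>. If \<open>x \<subseteq> A\<^sub>m\<close> with \<open>m \<le> n\<close>
  and \<open>k\<close> elements of \<open>x\<close> lie outside \<open>A\<^sub>m\<^sub>-\<^sub>1\<close>, this criterion says that \<open>k \<le> n - m\<close> and that
  \<open>x \<inter> A\<^sub>m\<^sub>-\<^sub>1 \<in> A\<^sub>n\<^sub>-\<^sub>k\<close>. Splitting \<open>x\<close> into \<open>x \<inter> A\<^sub>m\<^sub>-\<^sub>1\<close> and \<open>x - A\<^sub>m\<^sub>-\<^sub>1\<close> and sorting by \<open>k\<close> gives the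
  recurrence; for \<open>k = n - m\<close> the condition \<open>x \<notin> A\<^sub>n\<^sub>-\<^sub>1\<close> is automatic, so that all of \<open>A\<^sub>m\<close>
  contributes.
\<close>

section \<open>Building hereditarily finite sets from sets of elements; monotonicity of
  \<open>A\<close>\<close>

definition hfset :: "hf set \<Rightarrow> hf" where
  "hfset S = HF (Abs_fset S)"

lemma fset_elts_hfset [simp]: "finite S \<Longrightarrow> fset (elts (hfset S)) = S"
  by (simp add: hfset_def Abs_fset_inverse)

lemma hfset_fset_elts [simp]: "hfset (fset (elts x)) = x"
  by (simp add: hfset_def fset_inverse)

lemma fset_elts_empty_iff: "fset (elts x) = {} \<longleftrightarrow> x = hempty"
  by (cases x) (auto simp: hempty_def fset_inject[of _ "{||}", simplified])

lemma A_neg [simp]: "n < 0 \<Longrightarrow> A n = {}"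
  by (simp add: A_def)

lemma A_of_nat [simp]: "A (int n) = adj_level n"
  by (simp add: A_def)

lemma adj_level_Suc_mono: "adj_level n \<subseteq> adj_level (Suc n)"
proof (induction n)
  case (Suc n)
  then show ?case
    by (simp only: adj_level.simps) blast
qed simp

lemma adj_level_mono: "m \<le> n \<Longrightarrow> adj_level m \<subseteq> adj_level n"
  using lift_Suc_mono_le[of adj_level] adj_level_Suc_mono by blast

lemma A_mono: "m \<le> n \<Longrightarrow> A m \<subseteq> A n"
  using adj_level_mono[of "nat m" "nat n"] by (auto simp: A_def)

section \<open>The counting criterion for membership in a level\<close>

text \<open>The index \<open>j\<close> is i + 1 in the criterion above, which makes it a natural
  number; \<open>j = 0\<close> bounds the size, since \<open>A (-1)\<close> is empty. Adjoining one
  element raises each count by at most one. Conversely, a nonempty set is obtained by adjoining an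
  element of highest level to the rest.\<close>

lemma adj_level_iff:
  "x \<in> adj_level n \<longleftrightarrow> (\<forall>j\<le>n. card (fset (elts x) - A (int j - 1)) + j \<le> n)"
proof (induction n arbitrary: x)
  case 0
  show ?case
    by (cases x) (auto simp: hempty_def)
next
  case (Suc n)
  show ?case
  proof
    assume "x \<in> adj_level (Suc n)"
    then consider "x = hempty"
      | x' y where "x = adjoin x' y" "x' \<in> adj_level n" "y \<in> adj_level n"
      by auto
    then show "\<forall>j\<le>Suc n. card (fset (elts x) - A (int j - 1)) + j \<le> Suc n"
    proof cases
      case 1
      then show ?thesis by (simp add: hempty_def)
    next
      case 2
      have x: "fset (elts x) = insert y (fset (elts x'))"
        using 2 by (simp add: adjoin_def)
      have IH: "card (fset (elts x') - A (int j - 1)) + j \<le> n" if "j \<le> n" for j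
        using 2 Suc that by blast
      show ?thesis
      proof (intro allI impI)
        fix j assume "j \<le> Suc n"
        show "card (fset (elts x) - A (int j - 1)) + j \<le> Suc n"
        \<comment> \<open>At \<open>j = Suc n\<close> there is no room for \<open>y\<close>: the
          count must be 0, which holds because \<open>y\<close> and all elements of
          \<open>x'\<close> lie in \<open>A (int n)\<close>.\<close>
        proof (cases "j = Suc n")
          case True
          have "fset (elts x') \<subseteq> A (int n - 1)"
            using IH[of n] by simp
          also have "\<dots> \<subseteq> A (int n)"
            by (rule A_mono) simp
          finally have "fset (elts x) \<subseteq> A (int n)"
            using x 2 by simp
          then have "fset (elts x) - A (int j - 1) = {}"
            using True by auto
          then show ?thesis
            using True by simp
        next
          case False
          have "card (fset (elts x) - A (int j - 1))
              \<le> card (insert y (fset (elts x') - A (int j - 1)))"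
            by (rule card_mono) (auto simp: x)
          also have "\<dots> \<le> Suc (card (fset (elts x') - A (int j - 1)))"
            by (simp add: card_insert_if)
          finally show ?thesis
            using IH[of j] False \<open>j \<le> Suc n\<close> by simp
        qed
      qed
    qed
  next
    assume *: "\<forall>j\<le>Suc n. card (fset (elts x) - A (int j - 1)) + j \<le> Suc n"
    show "x \<in> adj_level (Suc n)"
    proof (cases "fset (elts x) = {}")
      case True
      then show ?thesis
        by (simp add: fset_elts_empty_iff)
    next
      case False
      have sub: "fset (elts x) \<subseteq> adj_level n"
        using *[rule_format, of "Suc n"] by simp
      \<comment> \<open>\<open>J\<close> collects the indices up to \<open>n\<close> with a nonzero
        count. An element \<open>y\<close> outside \<open>A (int (Max J) - 1)\<close> is counted at
        every \<open>j\<close> in \<open>J\<close>, so removing it lowers each of these counts by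
        one.\<close>
      define J where "J = {j. j \<le> n \<and> \<not> fset (elts x) \<subseteq> A (int j - 1)}"
      have J: "finite J" "J \<noteq> {}"
        using False by (auto simp: J_def intro!: exI[of _ 0])
      obtain y where y: "y \<in> fset (elts x)" "y \<notin> A (int (Max J) - 1)"
        using Max_in[OF J] by (auto simp: J_def)
      define x' where "x' = hfset (fset (elts x) - {y})"
      have elts_x': "fset (elts x') = fset (elts x) - {y}"
        by (simp add: x'_def)
      have "card (fset (elts x') - A (int j - 1)) + j \<le> n" if "j \<le> n" for j
      proof (cases "j \<in> J")
        case True
        then have "j \<le> Max J"
          using J by (intro Max_ge)
        then have "A (int j - 1) \<subseteq> A (int (Max J) - 1)"
          by (intro A_mono) linarith
        then have "y \<in> fset (elts x) - A (int j - 1)"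
          using y by auto
        then have "Suc (card (fset (elts x) - A (int j - 1) - {y}))
            = card (fset (elts x) - A (int j - 1))"
          by (intro card_Suc_Diff1) auto
        moreover have "fset (elts x') - A (int j - 1) = fset (elts x) - A (int j - 1) - {y}"
          using elts_x' by auto
        ultimately show ?thesis
          using *[rule_format, of j] that by simp
      next
        case False
        then have "fset (elts x') - A (int j - 1) = {}"
          using that elts_x' by (auto simp: J_def)
        then show ?thesis
          using that by (simp only: card.empty)
      qed
      then have "x' \<in> adj_level n"
        using Suc by blast
      moreover have "x = adjoin x' y"
      proof -
        have "fset (elts x) = fset (elts (adjoin x' y))"
          using y elts_x' by (auto simp: adjoin_def)
        then show ?thesis
          by (metis hfset_fset_elts)
      qed
      ultimately show ?thesis
        using y sub by auto
    qed
  qed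
qed

lemma elts_subset_A: "x \<in> A n \<Longrightarrow> fset (elts x) \<subseteq> A (n - 1)"
proof (cases n)
  case (nonneg k)
  assume "x \<in> A n"
  then have "card (fset (elts x) - A (int k - 1)) + k \<le> k"
    using nonneg unfolding nonneg A_of_nat adj_level_iff by blast
  then show ?thesis
    using nonneg by simp
qed simp

text \<open>Compare the counts in \<open>adj_level_iff\<close>. For \<open>j <= m\<close> all
  \<open>k\<close> elements outside \<open>A (int m - 1)\<close> are counted, so removing them
  lowers the count by exactly \<open>k\<close>; for \<open>j > m\<close> both counts vanish. The
  index \<open>j = m\<close> yields \<open>k <= n - m\<close>.\<close>

lemma A_level_split:
  fixes n m :: nat
  assumes "fset (elts x) \<subseteq> A (int m)" "m \<le> n"
  defines "k \<equiv> card (fset (elts x) - A (int m - 1))"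
  shows "x \<in> A (int n) \<longleftrightarrow>
    k \<le> n - m \<and> hfset (fset (elts x) \<inter> A (int m - 1)) \<in> A (int (n - k))"
proof -
  define u where "u = hfset (fset (elts x) \<inter> A (int m - 1))"
  have u: "fset (elts u) = fset (elts x) \<inter> A (int m - 1)"
    by (simp add: u_def)
  have card_x: "card (fset (elts x) - A (int j - 1)) = card (fset (elts u) - A (int j - 1)) + k"
    if "j \<le> m" for j
  proof -
    have "A (int j - 1) \<subseteq> A (int m - 1)"
      using that by (intro A_mono) simp
    then have "fset (elts x) - A (int j - 1)
        = (fset (elts u) - A (int j - 1)) \<union> (fset (elts x) - A (int m - 1))"
      using u by auto
    then show ?thesis
      unfolding k_def by (simp add: card_Un_disjoint u Int_Diff disjoint_iff)
  qed
  have card_u: "card (fset (elts u) - A (int j - 1)) = 0" if "m \<le> j" for j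
  proof -
    have "A (int m - 1) \<subseteq> A (int j - 1)"
      using that by (intro A_mono) simp
    then have "fset (elts u) - A (int j - 1) = {}"
      using u by auto
    then show ?thesis by simp
  qed
  have card_x': "card (fset (elts x) - A (int j - 1)) = 0" if "m < j" for j
  proof -
    have "A (int m) \<subseteq> A (int j - 1)"
      using that by (intro A_mono) simp
    then have "fset (elts x) - A (int j - 1) = {}"
      using assms(1) by auto
    then show ?thesis by simp
  qed
  show ?thesis
  proof
    assume "x \<in> A (int n)"
    then have *: "card (fset (elts x) - A (int j - 1)) + j \<le> n" if "j \<le> n" for j
      using that by (simp add: adj_level_iff)
    have k: "k \<le> n - m"
      using *[of m] assms by simp
    moreover have "card (fset (elts u) - A (int j - 1)) + j \<le> n - k" if "j \<le> n - k" for j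
    proof (cases "j \<le> m")
      case True
      then show ?thesis using *[of j] card_x[of j] assms(2) by linarith
    next
      case False
      then show ?thesis using card_u[of j] that by linarith
    qed
    ultimately show "k \<le> n - m \<and> hfset (fset (elts x) \<inter> A (int m - 1)) \<in> A (int (n - k))"
      unfolding A_of_nat adj_level_iff u_def[symmetric] by blast
  next
    assume k: "k \<le> n - m \<and> hfset (fset (elts x) \<inter> A (int m - 1)) \<in> A (int (n - k))"
    then have *: "card (fset (elts u) - A (int j - 1)) + j \<le> n - k" if "j \<le> n - k" for j
      using that unfolding A_of_nat adj_level_iff u_def[symmetric] by blast
    have "card (fset (elts x) - A (int j - 1)) + j \<le> n" if "j \<le> n" for j
    proof (cases "j \<le> m")
      case True
      then show ?thesis using *[of j] card_x[of j] k assms(2) by linarith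
    next
      case False
      then show ?thesis using card_x'[of j] that by linarith
    qed
    then show "x \<in> A (int n)"
      by (simp add: adj_level_iff)
  qed
qed

section \<open>Counting\<close>

lemma bnum_pred: "bnum m (m - 1) = card (A m - A (m - 1))"
  unfolding bnum_def using elts_subset_A by (intro arg_cong[where f = card]) blast

text \<open>The differences \<open>A k - A (k - 1)\<close> partition \<open>A m\<close>, and the
  inclusion condition in \<open>Dset\<close> is automatic by \<open>elts_subset_A\<close>.\<close>

lemma sum_dnum_pred:
  "(\<Sum>k = 0..m. dnum s (int k) (int k - 1)) = card {x \<in> A (int m). int (fcard (elts x)) \<le> s}"
proof (induction m)
  case 0
  show ?case
    using elts_subset_A[of _ 0]
    by (auto simp: dnum_def Dset_def intro!: arg_cong[where f = card])
next
  case (Suc m)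
  let ?L = "{x \<in> A (int m). int (fcard (elts x)) \<le> s}"
  have "{x \<in> A (int (Suc m)). int (fcard (elts x)) \<le> s} = ?L \<union> Dset s (int (Suc m)) (int m)"
    using elts_subset_A[of _ "int (Suc m)"] A_mono[of "int m" "int (Suc m)"]
    by (auto simp: Dset_def)
  moreover have "?L \<inter> Dset s (int (Suc m)) (int m) = {}"
    by (auto simp: Dset_def)
  ultimately show ?case
    using Suc by (simp add: dnum_def card_Un_disjoint finite_Dset finite_adj_level)
qed

lemma dnum_recurrence:
  fixes n m :: nat
  assumes "m < n"
  shows "dnum t (int n) (int m) =
    dnum t (int n) (int m - 1)
    + (\<Sum>k = 1..n - m - 1.
        dnum (t - int k) (int n - int k) (int m - 1) * (bnum (int m) (int m - 1) choose k))
    + (bnum (int m) (int m - 1) choose (n - m))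
      * (\<Sum>k = 0..m. dnum (t - int n + int m) (int k) (int k - 1))"
proof -
  define B where "B = A (int m - 1)"
  define R where "R = A (int m) - B"
  \<comment> \<open>\<open>U k\<close> holds the low parts that can be joined to a high part from
    \<open>V k\<close>; the high part uses up \<open>k\<close> of the size bound.\<close>
  define U where "U k = (if k = n - m then {u \<in> A (int m). int (fcard (elts u)) \<le> t - int k}
    else Dset (t - int k) (int (n - k)) (int m - 1))" for k
  define V where "V k = {v. v \<subseteq> R \<and> card v = k}" for k
  have fin_R: "finite R"
    unfolding R_def by (intro finite_Diff finite_A)
  have R_disj: "R \<inter> B = {}"
    by (auto simp: R_def)
  have B_sub: "B \<subseteq> A (int m)"
    unfolding B_def by (rule A_mono) simp
  have U_sub: "fset (elts u) \<subseteq> B" if "u \<in> U k" for u k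
    using that elts_subset_A[of u "int m"] by (auto simp: U_def B_def Dset_def split: if_splits)
  have fin_U: "finite (U k)" for k
    by (simp add: U_def finite_Dset finite_adj_level)
  have fin_V: "finite (V k)" for k
    using fin_R by (simp add: V_def)
  have level: "x \<in> A (int n) - A (int n - 1) \<and> int (fcard (elts x)) \<le> t \<longleftrightarrow>
      k \<le> n - m \<and> hfset (fset (elts x) \<inter> B) \<in> U k"
    if sub: "fset (elts x) \<subseteq> A (int m)" and k: "k = card (fset (elts x) - B)" for x k
  proof -
    define u where "u = hfset (fset (elts x) \<inter> B)"
    have u: "fset (elts u) = fset (elts x) \<inter> B"
      by (simp add: u_def)
    have "fset (elts x) = fset (elts u) \<union> (fset (elts x) - B)"
      using u by auto
    then have "card (fset (elts x)) = card (fset (elts u)) + k"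
      unfolding k by (subst card_Un_disjoint[symmetric]) (auto simp: u)
    then have card_x: "fcard (elts x) = fcard (elts u) + k"
      by (simp add: fcard.rep_eq)
    have iff_n: "x \<in> A (int n) \<longleftrightarrow> k \<le> n - m \<and> u \<in> A (int (n - k))"
      using A_level_split[OF sub, of n] assms by (simp add: k u_def B_def)
    have iff_n': "x \<in> A (int n - 1) \<longleftrightarrow> k \<le> n - 1 - m \<and> u \<in> A (int (n - 1 - k))"
      using A_level_split[OF sub, of "n - 1"] assms by (simp add: k u_def B_def of_nat_diff)
    show ?thesis
    \<comment> \<open>Below \<open>n - m\<close>, membership in both levels depends on
      \<open>u\<close> alone. At \<open>k = n - m\<close> the bound \<open>k <= n - 1 - m\<close>
      fails, so \<open>x\<close> is automatically outside \<open>A (int n - 1)\<close>; for larger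
      \<open>k\<close> both sides are false.\<close>
    proof (cases "k < n - m")
      case True
      then have "k \<le> n - 1 - m" "int (n - 1 - k) = int (n - k) - 1"
        by simp_all
      with iff_n' have "x \<in> A (int n - 1) \<longleftrightarrow> u \<in> A (int (n - k) - 1)"
        by metis
      then show ?thesis
        using True iff_n card_x u unfolding u_def[symmetric]
        by (auto simp: U_def Dset_def B_def)
    next
      case False
      then show ?thesis
        using iff_n iff_n' card_x assms unfolding u_def[symmetric]
        by (auto simp: U_def)
    qed
  qed
  let ?S = "SIGMA k:{0..n - m}. U k \<times> V k"
  let ?f = "\<lambda>x. (card (fset (elts x) - B), hfset (fset (elts x) \<inter> B), fset (elts x) - B)"
  let ?g = "\<lambda>(k, u, v). hfset (fset (elts u) \<union> v)"
  \<comment> \<open>\<open>B\<close> separates the union again: the elements of \<open>u\<close> lie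
    inside it, and \<open>v\<close>, a subset of \<open>R\<close>, is disjoint from it.\<close>
  have g_elts: "fset (elts (?g (k, u, v))) = fset (elts u) \<union> v"
      "(fset (elts u) \<union> v) \<inter> B = fset (elts u)" "(fset (elts u) \<union> v) - B = v"
    if "u \<in> U k" "v \<in> V k" for k u v
    using that U_sub[of u k] R_disj finite_subset[OF _ fin_R, of v] by (auto simp: V_def)
  have "bij_betw ?f (Dset t (int n) (int m)) ?S"
  proof (rule bij_betw_byWitness[where f' = ?g])
    show "\<forall>x\<in>Dset t (int n) (int m). ?g (?f x) = x"
      by (auto simp: Int_Diff_Un)
    show "\<forall>p\<in>?S. ?f (?g p) = p"
      using g_elts by (auto simp: V_def)
    show "?f ` Dset t (int n) (int m) \<subseteq> ?S"
    proof (rule image_subsetI)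
      fix x assume x: "x \<in> Dset t (int n) (int m)"
      then have "fset (elts x) \<subseteq> A (int m)"
        by (auto simp: Dset_def)
      moreover from this have "fset (elts x) - B \<subseteq> R"
        by (auto simp: R_def)
      ultimately show "?f x \<in> ?S"
        using level[OF _ refl, of x] x by (auto simp: Dset_def V_def)
    qed
    show "?g ` ?S \<subseteq> Dset t (int n) (int m)"
    proof (rule image_subsetI)
      fix p assume "p \<in> ?S"
      then obtain k u v where p: "p = (k, u, v)" and k: "k \<le> n - m" and uv: "u \<in> U k" "v \<in> V k"
        by auto
      note g = g_elts[OF uv]
      have sub: "fset (elts (?g p)) \<subseteq> A (int m)"
        unfolding p g using uv U_sub[of u k] B_sub by (auto simp: V_def R_def)
      have "k = card (fset (elts (?g p)) - B)"
        unfolding p g using uv by (simp add: V_def)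
      moreover have "hfset (fset (elts (?g p)) \<inter> B) \<in> U k"
        unfolding p g using uv by simp
      ultimately show "?g p \<in> Dset t (int n) (int m)"
        using level[OF sub] sub k by (auto simp: Dset_def)
    qed
  qed
  then have "dnum t (int n) (int m) = card ?S"
    by (simp add: dnum_def bij_betw_same_card)
  also have "\<dots> = (\<Sum>k = 0..n - m. card (U k) * (card R choose k))"
    using fin_U fin_V n_subsets[OF fin_R] by (simp add: card_cartesian_product V_def)
  also have "\<dots> = card (U 0) + (\<Sum>k = 1..n - m - 1. card (U k) * (card R choose k))
      + card (U (n - m)) * (card R choose (n - m))"
  proof -
    \<comment> \<open>Since \<open>m < n\<close>, the end terms \<open>k = 0\<close> and
      \<open>k = n - m\<close> are distinct and can both be split off.\<close>
    have "n - m = Suc (n - m - 1)"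
      using assms by simp
    then show ?thesis
      by (metis (no_types, lifting) sum.atLeast0_atMost_Suc sum.atLeast_Suc_atMost binomial_n_0
          mult_1_right One_nat_def zero_le)
  qed
  also have "card (U 0) = dnum t (int n) (int m - 1)"
    using assms by (simp add: U_def dnum_def)
  also have "(\<Sum>k = 1..n - m - 1. card (U k) * (card R choose k)) =
      (\<Sum>k = 1..n - m - 1. dnum (t - int k) (int n - int k) (int m - 1) * (card R choose k))"
    by (intro sum.cong refl) (auto simp: U_def dnum_def of_nat_diff)
  \<comment> \<open>Here \<open>U (n - m)\<close> is all of \<open>A (int m)\<close> up to the size
    bound, counted level by level.\<close>
  also have "card (U (n - m)) = (\<Sum>k = 0..m. dnum (t - int n + int m) (int k) (int k - 1))"
    using assms by (simp add: U_def sum_dnum_pred of_nat_diff algebra_simps)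
  finally show ?thesis
    by (simp add: bnum_pred R_def B_def mult.commute)
qed

theorem theorem4:
  "(\<forall>n m t :: nat. m < n \<and> t \<le> n \<longrightarrow>
      dnum (int t) (int n) (int m) =
        dnum (int t) (int n) (int m - 1)
        + (\<Sum>k = 1..n - m - 1.
            dnum (int t - int k) (int n - int k) (int m - 1)
            * (bnum (int m) (int m - 1) choose k))
        + (bnum (int m) (int m - 1) choose (n - m))
          * (\<Sum>k = 0..m. dnum (int t - int n + int m) (int k) (int k - 1)))
   \<and> (\<forall>t :: nat. dnum (int t) 0 (-1) = 1)
   \<and> (\<forall>n t :: nat. n \<ge> 1 \<longrightarrow> dnum (int t) (int n) (-1) = 0)"
proof (intro conjI allI impI)
  fix n m t :: nat
  assume "m < n \<and> t \<le> n"
  then show "dnum (int t) (int n) (int m) =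
        dnum (int t) (int n) (int m - 1)
        + (\<Sum>k = 1..n - m - 1.
            dnum (int t - int k) (int n - int k) (int m - 1)
            * (bnum (int m) (int m - 1) choose k))
        + (bnum (int m) (int m - 1) choose (n - m))
          * (\<Sum>k = 0..m. dnum (int t - int n + int m) (int k) (int k - 1))"
    by (intro dnum_recurrence) simp
next
  fix t :: nat
  have "Dset (int t) 0 (-1) = {hempty}"
    by (auto simp: Dset_def A_def fset_elts_empty_iff) (simp add: hempty_def fcard.rep_eq)
  then show "dnum (int t) 0 (-1) = 1"
    by (simp add: dnum_def)
next
  fix n t :: nat
  assume "n \<ge> 1"
  \<comment> \<open>Only the empty set is included in \<open>A (-1)\<close>, and it already belongs
    to \<open>A 0\<close>.\<close>
  then have "A 0 \<subseteq> A (int n - 1)"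
    by (intro A_mono) simp
  moreover have "x \<in> A 0" if "fset (elts x) = {}" for x
    using that by (simp add: A_def fset_elts_empty_iff)
  ultimately have "Dset (int t) (int n) (-1) = {}"
    by (auto simp: Dset_def)
  then show "dnum (int t) (int n) (-1) = 0"
    by (simp add: dnum_def)
qed

end
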